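(* Let $d$ be an integer greater than or equal to $3$. Then there exists a constant $K>0$ such that, for all $\gamma\in PSL(d,\mathbb{Z})$, $$d_W(1,\gamma)\le K\log\|\gamma\|.$$
   Context: $PSL(d,\mathbb{Z})$ is the quotient of $SL(d,\mathbb{Z})$ by its subgroup of scalar matrices. For $g\in SL(d,\mathbb{Z})$, $\|g\|=\sup_{\|\mathbf{x}\|=1}\|g\mathbf{x}\|$ is the operator norm with respect to the Euclidean norm; since $\|g\|=\|-g\|$, the norm of a coset $\gamma=[g]\in PSL(d,\mathbb{Z})$ is defined by $\|\gamma\|=\|g\|$. $d_W$ is the word distance function on $PSL(d,\mathbb{Z})$ induced by a finite generating set $\Sigma$: $d_W(\gamma_1,\gamma_2)$ is the smallest integer $n\ge0$ such that $\gamma_1^{-1}\gamma_2$ may be written as a word of length $n$ in elements of $\Sigma\cup\Sigma^{-1}$.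
   Formalization: The inequality is asserted for γ = 1 and for all γ with ‖γ‖ > 1; nontrivial γ with ‖γ‖ = 1 (classes of signed permutation matrices, e.g. diag(-1,-1,1) for d = 3) are excluded, since there log‖γ‖ = 0 but d_W(1,γ) ≥ 1, so the claim fails for every K. *)

theory Defs
  imports "HOL-Analysis.Analysis" "HOL-Algebra.Coset" "HOL-Algebra.Generated_Groups"
begin

definition SLZ :: "(int ^ 'd ^ 'd) monoid" where
  "SLZ = \<lparr>carrier = {A. det A = 1}, mult = (**), one = mat 1\<rparr>"

definition SLZ_scalars :: "(int ^ 'd ^ 'd) set" where
  "SLZ_scalars = {A \<in> carrier SLZ. \<exists>c. A = mat c}"

definition PSLZ :: "(int ^ 'd ^ 'd) set monoid" where
  "PSLZ = SLZ Mod SLZ_scalars"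

definition SLZ_norm :: "int ^ 'd ^ 'd \<Rightarrow> real" where
  "SLZ_norm A = onorm (\<lambda>x :: real ^ 'd. (\<chi> i j. real_of_int (A $ i $ j)) *v x)"

text \<open>The norm is constant on each coset, see \<open>PSLZ_norm_coset\<close> below. Beware that it takes
  the value 1 not only at the identity but at the classes of all signed permutation matrices of
  determinant 1. There \<open>ln (PSLZ_norm \<gamma>) = 0\<close>, so no multiple of the logarithm of the norm can
  bound the word length of these elements unless they are trivial.\<close>

definition PSLZ_norm :: "(int ^ 'd ^ 'd) set \<Rightarrow> real" where
  "PSLZ_norm \<gamma> = the_elem (SLZ_norm ` \<gamma>)"

text \<open>Meaningful only if \<open>S\<close> generates \<open>G\<close>: otherwise there may be no word at all, and
  \<open>LEAST\<close> is unspecified.\<close>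

definition word_dist :: "('a, 'b) monoid_scheme \<Rightarrow> 'a set \<Rightarrow> 'a \<Rightarrow> 'a \<Rightarrow> nat" where
  "word_dist G S a b = (LEAST n. \<exists>ws. length ws = n \<and> set ws \<subseteq> S \<union> m_inv G ` S \<and>
     inv\<^bsub>G\<^esub> a \<otimes>\<^bsub>G\<^esub> b = foldr (\<otimes>\<^bsub>G\<^esub>) ws \<one>\<^bsub>G\<^esub>)"

lemma SLZ_simps [simp]:
  "carrier SLZ = {A. det A = 1}" "A \<otimes>\<^bsub>SLZ\<^esub> B = A ** B" "\<one>\<^bsub>SLZ\<^esub> = mat 1"
  by (simp_all add: SLZ_def)

abbreviation rmat :: "int ^ 'd ^ 'd \<Rightarrow> real ^ 'd ^ 'd" where
  "rmat A \<equiv> (\<chi> i j. real_of_int (A $ i $ j))"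

lemma det_rmat: "det (rmat A) = real_of_int (det A)"
  by (simp add: det_def)

lemma rmat_mult: "rmat (A ** B) = rmat A ** rmat B"
  by (simp add: matrix_matrix_mult_def vec_eq_iff)

lemma rmat_mat: "rmat (mat c) = mat (real_of_int c)"
  by (simp add: mat_def vec_eq_iff)

lemma rmat_inject: "rmat A = rmat B \<longleftrightarrow> A = B"
  by (simp add: vec_eq_iff)

lemma SLZ_left_inverse:
  fixes A :: "int ^ 'd ^ 'd"
  assumes "det A = 1"
  shows "\<exists>B. det B = 1 \<and> B ** A = mat 1"
proof -
  define B :: "int ^ 'd ^ 'd" where
    "B = (\<chi> i j. det (\<chi> k l. if l = i then axis j 1 $ k else A $ k $ l))"
  have d: "det (rmat A) = 1"
    using assms by (simp add: det_rmat)
  have col: "rmat A *v column j (rmat B) = axis j 1" for j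
  proof -
    have "real_of_int (B $ i $ j) =
        det (\<chi> k l. if l = i then axis j 1 $ k else rmat A $ k $ l)" for i
    proof -
      have eq: "(\<chi> k l. if l = i then axis j 1 $ k else rmat A $ k $ l) =
          rmat (\<chi> k l. if l = i then axis j 1 $ k else A $ k $ l)"
        by (auto simp: vec_eq_iff axis_def)
      show ?thesis
        unfolding B_def eq det_rmat by simp
    qed
    then have "column j (rmat B) =
        (\<chi> i. det (\<chi> k l. if l = i then axis j 1 $ k else rmat A $ k $ l) / det (rmat A))"
      by (simp add: column_def vec_eq_iff d)
    then show ?thesis
      using d by (subst cramer) auto
  qed
  have "(rmat A ** rmat B) $ i $ j = mat 1 $ i $ j" for i j
  proof -
    have "(rmat A ** rmat B) $ i $ j = (rmat A *v column j (rmat B)) $ i"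
      by (simp add: matrix_matrix_mult_def matrix_vector_mult_def column_def)
    also have "\<dots> = mat 1 $ i $ j"
      unfolding col by (simp add: axis_def mat_def)
    finally show ?thesis .
  qed
  then have "rmat A ** rmat B = mat 1"
    by (simp only: vec_eq_iff) blast
  then have "rmat B ** rmat A = mat 1"
    by (simp add: matrix_left_right_inverse)
  then have BA: "B ** A = mat 1"
    using rmat_inject [of "B ** A" "mat 1"] by (simp add: rmat_mult rmat_mat)
  then have "det B * det A = 1"
    by (metis det_I det_mul)
  with BA assms show ?thesis
    by auto
qed

lemma group_SLZ: "group SLZ"
  by (rule groupI) (auto simp: det_mul matrix_mul_assoc SLZ_left_inverse)

lemma mat_mult: "mat c ** (A :: 'a::comm_semiring_1 ^ 'd ^ 'd) = (\<chi> i j. c * A $ i $ j)"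
  by (simp add: matrix_matrix_mult_def mat_def vec_eq_iff if_distrib [of "\<lambda>x. x * _"]
      sum.delta cong: if_cong)

lemma mult_mat: "(A :: 'a::comm_semiring_1 ^ 'd ^ 'd) ** mat c = mat c ** A"
  unfolding mat_mult
  by (simp add: matrix_matrix_mult_def mat_def vec_eq_iff if_distrib [of "\<lambda>x. _ * x"]
      sum.delta mult.commute cong: if_cong)

lemma normal_SLZ_scalars: "(SLZ_scalars :: (int ^ 'd ^ 'd) set) \<lhd> SLZ"
proof -
  interpret group "SLZ :: (int ^ 'd ^ 'd) monoid" by (rule group_SLZ)
  have "subgroup (SLZ_scalars :: (int ^ 'd ^ 'd) set) SLZ"
  proof (rule subgroupI)
    fix A B :: "int ^ 'd ^ 'd"
    assume A: "A \<in> SLZ_scalars"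
    then obtain c where c: "A = mat c" "det A = 1"
      by (auto simp: SLZ_scalars_def)
    let ?B = "inv\<^bsub>SLZ\<^esub> A"
    have B: "det ?B = 1" "?B ** A = mat 1"
      using inv_closed [of A] l_inv [of A] c(2) by auto
    have e: "c * ?B $ i $ j = mat 1 $ i $ j" for i j
      using B(2) unfolding c(1) mult_mat mat_mult by (simp add: vec_eq_iff)
    have cc: "c * c = 1"
      using e [of undefined undefined] by (simp add: mat_def) (auto simp: zmult_eq_1_iff)
    have "?B $ i $ j = mat c $ i $ j" for i j
    proof -
      have "?B $ i $ j = c * (c * ?B $ i $ j)"
        using cc by (simp add: mult.assoc [symmetric])
      then show ?thesis
        by (simp add: e mat_def)
    qed
    then have "?B = mat c"
      by (simp add: vec_eq_iff)
    then show "?B \<in> SLZ_scalars"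
      using B(1) by (auto simp: SLZ_scalars_def)
    assume "B \<in> SLZ_scalars"
    then obtain b where b: "B = mat b" "det B = 1"
      by (auto simp: SLZ_scalars_def)
    have AB: "A ** B = mat (c * b)"
      unfolding b c mat_mult by (simp add: mat_def vec_eq_iff)
    have "det (A ** B) = 1"
      using b(2) c(2) by (simp add: det_mul)
    then show "A \<otimes>\<^bsub>SLZ\<^esub> B \<in> SLZ_scalars"
      using AB by (auto simp: SLZ_scalars_def)
  qed (auto simp: SLZ_scalars_def intro!: exI [of _ "mat 1"])
  then show ?thesis
    by (rule normalI) (auto simp: r_coset_def l_coset_def SLZ_scalars_def mult_mat)
qed

lemma group_PSLZ: "group PSLZ"
  unfolding PSLZ_def by (rule normal.factorgroup_is_group [OF normal_SLZ_scalars])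

lemma PSLZ_norm_coset:
  fixes A :: "int ^ 'd ^ 'd"
  assumes "\<gamma> \<in> carrier PSLZ" "A \<in> \<gamma>"
  shows "PSLZ_norm \<gamma> = SLZ_norm A"
proof -
  obtain g :: "int ^ 'd ^ 'd" where g: "\<gamma> = SLZ_scalars #>\<^bsub>SLZ\<^esub> g"
    using assms(1) by (auto simp: PSLZ_def FactGroup_def RCOSETS_def)
  have n: "SLZ_norm B = SLZ_norm g" if B: "B \<in> \<gamma>" for B
  proof -
    obtain c where c: "B = mat c ** g" "det (mat c :: int ^ 'd ^ 'd) = 1"
      using B by (auto simp: g r_coset_def SLZ_scalars_def)
    have "c ^ CARD('d) = 1"
      using c(2) by (simp add: det_diagonal mat_def)
    then have "real_of_int (\<bar>c\<bar> ^ CARD('d)) = 1"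
      by (simp add: power_abs [symmetric] del: of_int_power)
    then have "\<bar>c\<bar> = 1"
      using power_eq_1_iff [of "\<bar>c\<bar>" "CARD('d)"] by simp
    have "rmat B *v x = real_of_int c *\<^sub>R (rmat g *v x)" for x
      unfolding c(1) by (simp add: mat_mult matrix_vector_mult_def vec_eq_iff sum_distrib_left mult.assoc)
    then have "(*v) (rmat B) = (\<lambda>x. real_of_int c *\<^sub>R (rmat g *v x))"
      by (rule ext)
    then have "SLZ_norm B = \<bar>real_of_int c\<bar> * SLZ_norm g"
      unfolding SLZ_norm_def
      by (simp only: onorm_scaleR [OF matrix_vector_mul_bounded_linear [of "rmat g"]])
    then show ?thesis
      using \<open>\<bar>c\<bar> = 1\<close> by (simp flip: of_int_abs)
  qed
  then have "SLZ_norm ` \<gamma> = {SLZ_norm A}"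
    using assms(2) by auto
  then show ?thesis
    by (simp add: PSLZ_norm_def)
qed

end

(* The idea: a transvection with entry n has word length O(log n), since over a two-dimensional
   block of commuting transvections a hyperbolic element H of SL(2,Z) acts by conjugation with
   H^j + H^(-j) = trace(H^j) I, and n has O(log n) bounded digits with respect to these traces.
   Row reduction by the Euclidean algorithm then costs O(log ||A||): the cost log(1 + |q|) of each
   division step with quotient q is paid by the decrease of log |x| + log |y|, and a bounded number
   of such reductions, each raising the norm at most to a fixed power, turns A into a diagonal
   matrix with entries 1 and -1. *)
theory Submission
  imports Defs
begin

section \<open>Word length in a group\<close>

text \<open>A third coordinate is essential: in PSL(2,Z) the class of a transvection with entry n
  has word length of order |n|. Given a further index k, the products E_ij(a) E_kj(b) form a copy of
  Z^2 on which the (i,k) block acts by conjugation. A second obstacle is that the bound admits no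
  additive constant. Reductions are therefore measured against an upper bound X >= 2 of the norm,
  where fixed costs are multiples of ln X; the return to the norm itself uses that norms above 1
  stay away from 1. Row operations act on the left and give g A = D, that is A^(-1) = D^(-1) g. What
  is estimated is thus the length of the inverse, which for word length is the same thing.\<close>

context group
begin

lemma foldr_mult_closed: "set ws \<subseteq> carrier G \<Longrightarrow> foldr (\<otimes>) ws \<one> \<in> carrier G"
  by (induction ws) auto

lemma foldr_mult_append:
  assumes "set us \<subseteq> carrier G" "set vs \<subseteq> carrier G"
  shows "foldr (\<otimes>) (us @ vs) \<one> = foldr (\<otimes>) us \<one> \<otimes> foldr (\<otimes>) vs \<one>"
  using assms by (induction us) (auto simp: m_assoc foldr_mult_closed)

lemma inv_foldr_mult:
  assumes "set ws \<subseteq> carrier G"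
  shows "inv (foldr (\<otimes>) ws \<one>) = foldr (\<otimes>) (rev (map (m_inv G) ws)) \<one>"
  using assms
proof (induction ws)
  case (Cons w ws)
  then have "foldr (\<otimes>) (rev (map (m_inv G) ws) @ [inv w]) \<one> =
      foldr (\<otimes>) (rev (map (m_inv G) ws)) \<one> \<otimes> inv w"
    by (subst foldr_mult_append) auto
  with Cons show ?case
    by (simp add: inv_mult_group foldr_mult_closed)
qed simp

lemma word_dist_one_le:
  assumes "g = foldr (\<otimes>) ws \<one>" "set ws \<subseteq> S \<union> m_inv G ` S" "g \<in> carrier G"
  shows "word_dist G S \<one> g \<le> length ws"
  unfolding word_dist_def using assms by (intro Least_le) auto

lemma generate_imp_word:
  assumes "S \<subseteq> carrier G" "g \<in> generate G S"
  shows "\<exists>ws. set ws \<subseteq> S \<union> m_inv G ` S \<and> g = foldr (\<otimes>) ws \<one>"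
  using assms(2)
proof induction
  case one
  show ?case by (intro exI [of _ "[]"]) auto
next
  case (incl h)
  with assms(1) show ?case by (intro exI [of _ "[h]"]) auto
next
  case (inv h)
  with assms(1) show ?case by (intro exI [of _ "[inv h]"]) auto
next
  case (eng g h)
  then obtain us vs where
    "set us \<subseteq> S \<union> m_inv G ` S" "g = foldr (\<otimes>) us \<one>"
    "set vs \<subseteq> S \<union> m_inv G ` S" "h = foldr (\<otimes>) vs \<one>" by blast
  moreover from this have "set us \<subseteq> carrier G" "set vs \<subseteq> carrier G"
    using assms(1) by auto
  ultimately show ?case
    by (intro exI [of _ "us @ vs"]) (use foldr_mult_append in auto)
qed

text \<open>Generation makes the condition under \<open>LEAST\<close> satisfiable, so the minimum is
  attained by an actual word; subadditivity and invariance under inversion are read off from such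
  shortest words.\<close>

lemma word_dist_one_word:
  assumes "S \<subseteq> carrier G" "generate G S = carrier G" "g \<in> carrier G"
  obtains ws where "set ws \<subseteq> S \<union> m_inv G ` S" "g = foldr (\<otimes>) ws \<one>"
    "length ws = word_dist G S \<one> g"
proof -
  let ?P = "\<lambda>n. \<exists>ws. length ws = n \<and> set ws \<subseteq> S \<union> m_inv G ` S \<and>
     inv \<one> \<otimes> g = foldr (\<otimes>) ws \<one>"
  have "\<exists>n. ?P n"
    using generate_imp_word [of S g] assms by auto
  then have "?P (word_dist G S \<one> g)"
    unfolding word_dist_def by (rule LeastI_ex)
  with assms(3) that show ?thesis by auto
qed

lemma word_dist_mult_le:
  assumes "S \<subseteq> carrier G" "generate G S = carrier G" "g \<in> carrier G" "h \<in> carrier G"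
  shows "word_dist G S \<one> (g \<otimes> h) \<le> word_dist G S \<one> g + word_dist G S \<one> h"
proof -
  obtain us where us: "set us \<subseteq> S \<union> m_inv G ` S" "g = foldr (\<otimes>) us \<one>"
    "length us = word_dist G S \<one> g"
    using word_dist_one_word assms by blast
  obtain vs where vs: "set vs \<subseteq> S \<union> m_inv G ` S" "h = foldr (\<otimes>) vs \<one>"
    "length vs = word_dist G S \<one> h"
    using word_dist_one_word assms by blast
  have "set us \<subseteq> carrier G" "set vs \<subseteq> carrier G"
    using us(1) vs(1) assms(1) by auto
  then have "g \<otimes> h = foldr (\<otimes>) (us @ vs) \<one>"
    using foldr_mult_append us(2) vs(2) by simp
  then have "word_dist G S \<one> (g \<otimes> h) \<le> length (us @ vs)"
    by (rule word_dist_one_le) (use us(1) vs(1) assms in auto)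
  with us(3) vs(3) show ?thesis
    by simp
qed

lemma word_dist_inv_le:
  assumes "S \<subseteq> carrier G" "generate G S = carrier G" "g \<in> carrier G"
  shows "word_dist G S \<one> (inv g) \<le> word_dist G S \<one> g"
proof -
  obtain us where us: "set us \<subseteq> S \<union> m_inv G ` S" "g = foldr (\<otimes>) us \<one>"
    "length us = word_dist G S \<one> g"
    using word_dist_one_word assms by blast
  have "set us \<subseteq> carrier G"
    using us(1) assms(1) by auto
  then have "inv g = foldr (\<otimes>) (rev (map (m_inv G) us)) \<one>"
    using inv_foldr_mult us(2) by simp
  moreover have "set (rev (map (m_inv G) us)) \<subseteq> S \<union> m_inv G ` S"
    using us(1) assms(1) by (auto simp: subset_iff image_iff)
  ultimately have "word_dist G S \<one> (inv g) \<le> length (rev (map (m_inv G) us))"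
    by (rule word_dist_one_le) (use assms in auto)
  with us(3) show ?thesis
    by simp
qed

lemma word_dist_one_one: "word_dist G S \<one> \<one> = 0"
  using word_dist_one_le [of \<one> "[]" S] by simp

end

section \<open>Norms of integer matrices\<close>

lemma SLZ_norm_mult_le: "SLZ_norm (A ** B) \<le> SLZ_norm A * SLZ_norm B"
proof -
  have "(\<lambda>x. rmat (A ** B) *v x) = (*v) (rmat A) \<circ> (*v) (rmat B)"
    by (rule ext) (simp add: rmat_mult matrix_vector_mul_assoc del: vec_lambda_beta)
  then show ?thesis
    unfolding SLZ_norm_def
    using onorm_compose [of "(*v) (rmat A)" "(*v) (rmat B)"] by simp
qed

lemma abs_nth_le_SLZ_norm: "real_of_int \<bar>A $ i $ j\<bar> \<le> SLZ_norm A"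
  unfolding SLZ_norm_def using matrix_component_le_onorm [of "rmat A" i j]
  by simp

lemma SLZ_norm_ge_1:
  fixes A :: "int ^ 'd ^ 'd"
  assumes "det A = 1"
  shows "SLZ_norm A \<ge> 1"
proof -
  have "A \<noteq> 0"
    using assms det_0 [where 'a = int and 'n = 'd] by (auto simp: mat_0)
  then obtain i j where "A $ i $ j \<noteq> 0"
    by (auto simp: vec_eq_iff)
  then have "real_of_int \<bar>A $ i $ j\<bar> \<ge> 1"
    by linarith
  with abs_nth_le_SLZ_norm show ?thesis
    by (rule order_trans [rotated])
qed

text \<open>Serves two finiteness arguments: only finitely many diagonal matrices can remain after
  the reduction, and only finitely many norms are at most 2.\<close>

lemma finite_bounded_int_matrices:
  "finite {A :: int ^ 'd ^ 'd. \<forall>i j. \<bar>A $ i $ j\<bar> \<le> m}" (is "finite ?S")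
proof -
  let ?F = "\<lambda>A :: int ^ 'd ^ 'd. \<lambda>(i, j). A $ i $ j"
  have "?F ` ?S \<subseteq> UNIV \<rightarrow>\<^sub>E {-m..m}"
    by (auto simp: abs_le_iff PiE_def) (smt (verit))+
  then have "finite (?F ` ?S)"
    by (rule finite_subset) (simp add: finite_PiE)
  moreover have "inj ?F"
    by (auto simp: inj_def vec_eq_iff fun_eq_iff)
  ultimately show ?thesis
    using finite_imageD inj_on_subset [OF _ subset_UNIV] by blast
qed

section \<open>Transvections\<close>

definition transvection :: "'d \<Rightarrow> 'd \<Rightarrow> int \<Rightarrow> int ^ 'd ^ 'd" where
  "transvection i j n = (\<chi> a b. of_bool (a = b) + (if a = i \<and> b = j then n else 0))"

lemma transvection_nth:
  "transvection i j n $ a $ b = of_bool (a = b) + (if a = i \<and> b = j then n else 0)"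
  by (simp add: transvection_def)

lemma transvection_mult_nth:
  "(transvection i j n ** A) $ a $ b = A $ a $ b + (if a = i then n * A $ j $ b else 0)"
proof -
  have "(transvection i j n ** A) $ a $ b =
      (\<Sum>k\<in>UNIV. (if a = k then A $ k $ b else 0) + (if k = j then (if a = i then n * A $ k $ b else 0) else 0))"
    unfolding matrix_matrix_mult_def transvection_def
    by (auto intro!: sum.cong simp: algebra_simps)
  then show ?thesis
    by (simp add: sum.distrib)
qed

lemma det_transvection:
  assumes "i \<noteq> j"
  shows "det (transvection i j n) = 1"
proof -
  have "transvection i j n = (\<chi> k. if k = i then row i (mat 1) + n *s row j (mat 1) else row k (mat 1))"
    by (auto simp: vec_eq_iff transvection_nth row_def mat_def)
  then show ?thesis
    using det_row_operation [OF assms, of "mat 1" n] by simp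
qed

lemma SLZ_norm_transvection: "SLZ_norm (transvection i j n) \<le> 1 + \<bar>real_of_int n\<bar>"
  unfolding SLZ_norm_def
proof (rule onorm_bound)
  fix x
  have "(rmat (transvection i j n) *v x) $ a = x $ a + (if a = i then real_of_int n * x $ j else 0)" for a
  proof -
    have "(rmat (transvection i j n) *v x) $ a =
        (\<Sum>b\<in>UNIV. (if a = b then x $ b else 0) + (if b = j then (if a = i then n * x $ b else 0) else 0))"
      unfolding matrix_vector_mult_def transvection_def
      by (auto intro!: sum.cong simp: algebra_simps)
    then show ?thesis
      by (simp add: sum.distrib)
  qed
  then have "rmat (transvection i j n) *v x = x + real_of_int n *\<^sub>R (x $ j) *\<^sub>R axis i 1"
    by (simp add: vec_eq_iff axis_def)
  then have "norm (rmat (transvection i j n) *v x) \<le> norm x + \<bar>real_of_int n\<bar> * \<bar>x $ j\<bar>"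
    using norm_triangle_ineq [of x "real_of_int n *\<^sub>R (x $ j) *\<^sub>R axis i 1"]
    by (simp add: abs_mult)
  also have "\<dots> \<le> norm x + \<bar>real_of_int n\<bar> * norm x"
    by (intro add_left_mono mult_left_mono component_le_norm_cart) auto
  finally show "norm (rmat (transvection i j n) *v x) \<le> (1 + \<bar>real_of_int n\<bar>) * norm x"
    by (simp add: algebra_simps)
qed simp

section \<open>Logarithmic length of transvections\<close>

text \<open>The powers of the matrix \<open>H = (2 1; 1 1)\<close> satisfy \<open>H\<^sup>j + H\<^sup>-\<^sup>j = T\<^sub>j I\<close>,
  where \<open>T\<^sub>j\<close> is the trace of \<open>H\<^sup>j\<close>.  The first columns of \<open>H\<^sup>j\<close> and
  \<open>H\<^sup>-\<^sup>j\<close> are \<open>(x, y)\<close> and \<open>(x - y, -y)\<close> for \<open>(x, y) = hyp j\<close>.\<close>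

primrec hyp :: "nat \<Rightarrow> int \<times> int" where
  "hyp 0 = (1, 0)"
| "hyp (Suc j) = (2 * fst (hyp j) + snd (hyp j), fst (hyp j) + snd (hyp j))"

definition hyp_trace :: "nat \<Rightarrow> int" where
  "hyp_trace j = 2 * fst (hyp j) - snd (hyp j)"

lemma hyp_bounds: "0 \<le> snd (hyp j) \<and> snd (hyp j) \<le> fst (hyp j) \<and> 2 ^ j \<le> fst (hyp j)"
  by (induction j) auto

lemma two_power_le_hyp_trace: "2 ^ j \<le> hyp_trace j"
  using hyp_bounds [of j] by (simp add: hyp_trace_def)

lemma hyp_trace_Suc_le: "hyp_trace (Suc j) \<le> 4 * hyp_trace j"
  using hyp_bounds [of j] by (simp add: hyp_trace_def)

text \<open>A greedy expansion with the traces as place values. Consecutive traces grow by a factor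
  of at most 4, which bounds the digits; the remainder \<open>r\<close> is what is left below
  \<open>hyp_trace 0 = 2\<close>, so 4 is a generous common bound.\<close>

lemma hyp_trace_digits:
  assumes "\<bar>n\<bar> < hyp_trace J"
  shows "\<exists>r d. \<bar>r\<bar> \<le> 4 \<and> (\<forall>j. \<bar>d j\<bar> \<le> 4) \<and> n = r + (\<Sum>j<J. d j * hyp_trace j)"
  using assms
proof (induction J arbitrary: n)
  case 0
  then have "\<bar>n\<bar> \<le> 4"
    by (simp add: hyp_trace_def)
  then show ?case
    by (intro exI [of _ n] exI [of _ "\<lambda>_. 0"]) auto
next
  case (Suc J)
  let ?T = "hyp_trace J"
  have T: "0 < ?T"
    using two_power_le_hyp_trace [of J] by (smt (verit) zero_less_power)
  obtain r d where d: "\<bar>r\<bar> \<le> 4" "\<forall>j. \<bar>d j\<bar> \<le> 4" "n mod ?T = r + (\<Sum>j<J. d j * hyp_trace j)"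
    using Suc.IH [of "n mod ?T"] T by auto
  \<comment> \<open>The remainder is nonnegative, so the quotient lies between -4 and 3: rounding
    down costs one unit on the negative side only.\<close>
  have "- 5 * ?T < n - n mod ?T" "n - n mod ?T < 4 * ?T"
    using Suc.prems hyp_trace_Suc_le [of J] T pos_mod_bound [of ?T n] pos_mod_sign [of ?T n] by linarith+
  then have "- 5 * ?T < n div ?T * ?T" "n div ?T * ?T < 4 * ?T"
    by (simp_all add: minus_mod_eq_div_mult)
  then have "- 5 < n div ?T" "n div ?T < 4"
    using T by (simp_all only: mult_less_cancel_right_pos)
  then have "\<forall>j. \<bar>(d(J := n div ?T)) j\<bar> \<le> 4"
    using d(2) by auto
  moreover have "n = r + (\<Sum>j<Suc J. (d(J := n div ?T)) j * hyp_trace j)"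
    using d(3) div_mult_mod_eq [of n ?T] by simp
  ultimately show ?case
    using d(1) by blast
qed

text \<open>Horner's scheme: the sum of \<open>d j\<close> times the j-th iterate of a linear map at
  (1, 0) is \<open>d 0\<close> times (1, 0) plus the map applied to the sum of shifted digits. Each
  digit costs one application of the map and one small vector, so the total is linear in
  \<open>J\<close>; building every iterate separately would be quadratic.\<close>

lemma horner_length_bound:
  fixes L :: "int \<Rightarrow> int \<Rightarrow> real" and x y :: "nat \<Rightarrow> int"
  assumes add: "\<And>a b a' b'. L (a + a') (b + b') \<le> L a b + L a' b'"
    and step: "\<And>a b. L (\<alpha> * a + \<beta> * b) (\<gamma> * a + \<delta> * b) \<le> L a b + c"
    and small: "\<And>a. \<bar>a\<bar> \<le> 4 \<Longrightarrow> L a 0 \<le> M"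
    and x: "x 0 = 1" "\<And>j. x (Suc j) = \<alpha> * x j + \<beta> * y j"
    and y: "y 0 = 0" "\<And>j. y (Suc j) = \<gamma> * x j + \<delta> * y j"
    and d: "\<And>j. \<bar>d j\<bar> \<le> 4"
  shows "L (\<Sum>j<J. d j * x j) (\<Sum>j<J. d j * y j) \<le> M + real J * (c + M)"
  using d
proof (induction J arbitrary: d)
  case 0
  then show ?case
    using small [of 0] by simp
next
  case (Suc J)
  let ?X = "\<Sum>j<J. d (Suc j) * x j" and ?Y = "\<Sum>j<J. d (Suc j) * y j"
  have "(\<Sum>j<Suc J. d j * x j) = d 0 + (\<alpha> * ?X + \<beta> * ?Y)"
    unfolding sum.lessThan_Suc_shift x
    by (simp add: distrib_left sum.distrib sum_distrib_left ac_simps)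
  moreover have "(\<Sum>j<Suc J. d j * y j) = 0 + (\<gamma> * ?X + \<delta> * ?Y)"
    unfolding sum.lessThan_Suc_shift y
    by (simp add: distrib_left sum.distrib sum_distrib_left ac_simps)
  ultimately have "L (\<Sum>j<Suc J. d j * x j) (\<Sum>j<Suc J. d j * y j) \<le>
      L (d 0) 0 + L (\<alpha> * ?X + \<beta> * ?Y) (\<gamma> * ?X + \<delta> * ?Y)"
    by (simp only: add)
  also have "\<dots> \<le> M + (L ?X ?Y + c)"
    using small Suc.prems step by (intro add_mono) auto
  also have "L ?X ?Y \<le> M + real J * (c + M)"
    using Suc.IH [of "d \<circ> Suc"] Suc.prems by simp
  finally show ?case
    by (simp add: algebra_simps)
qed

text \<open>Adding the first columns of H^j and H^(-j) cancels the second coordinates and leaves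
  (\<open>hyp_trace j\<close>, 0). Hence the digits of \<open>n\<close> give two Horner sums, one
  for H and one for its inverse (1 -1; -1 2), plus the remainder; these three pieces account for the
  3 in the bound.\<close>

lemma hyperbolic_length_bound:
  fixes L :: "int \<Rightarrow> int \<Rightarrow> real"
  assumes add: "\<And>a b a' b'. L (a + a') (b + b') \<le> L a b + L a' b'"
    and fwd: "\<And>a b. L (2 * a + b) (a + b) \<le> L a b + c"
    and bwd: "\<And>a b. L (a - b) (2 * b - a) \<le> L a b + c"
    and small: "\<And>a. \<bar>a\<bar> \<le> 4 \<Longrightarrow> L a 0 \<le> M"
    and c: "0 \<le> c" and n: "\<bar>n\<bar> < 2 ^ J"
  shows "L n 0 \<le> (2 * real J + 3) * (c + M)"
proof -
  obtain r d where d: "\<bar>r\<bar> \<le> 4" "\<And>j. \<bar>d j\<bar> \<le> 4" "n = r + (\<Sum>j<J. d j * hyp_trace j)"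
    using hyp_trace_digits [of n J] n two_power_le_hyp_trace [of J] by force
  define x y where "x = fst \<circ> hyp" and "y = snd \<circ> hyp"
  have 1: "L (\<Sum>j<J. d j * x j) (\<Sum>j<J. d j * y j) \<le> M + real J * (c + M)"
    by (rule horner_length_bound [where \<alpha> = 2 and \<beta> = 1 and \<gamma> = 1 and \<delta> = 1])
      (use add fwd small d in \<open>simp_all add: x_def y_def\<close>)
  have 2: "L (\<Sum>j<J. d j * (x j - y j)) (\<Sum>j<J. d j * (- y j)) \<le> M + real J * (c + M)"
    by (rule horner_length_bound [where \<alpha> = 1 and \<beta> = "-1" and \<gamma> = "-1" and \<delta> = 2])
      (use add bwd small d in \<open>simp_all add: x_def y_def algebra_simps\<close>)
  have "n = r + ((\<Sum>j<J. d j * x j) + (\<Sum>j<J. d j * (x j - y j)))"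
    unfolding d(3) by (simp add: hyp_trace_def x_def y_def sum.distrib [symmetric] algebra_simps)
  then have "L n 0 = L (r + ((\<Sum>j<J. d j * x j) + (\<Sum>j<J. d j * (x j - y j))))
      (0 + ((\<Sum>j<J. d j * y j) + (\<Sum>j<J. d j * (- y j))))"
    by (simp add: sum_negf)
  also have "\<dots> \<le> M + ((M + real J * (c + M)) + (M + real J * (c + M)))"
    by (rule order_trans [OF add] add_mono small d 1 2)+
  also have "\<dots> \<le> (2 * real J + 3) * (c + M)"
    using c by (simp add: algebra_simps)
  finally show ?thesis .
qed

text \<open>By the second assumption a bound on the length of a row operation also controls the
  growth of the norm it causes.\<close>

locale subadditive_length =
  fixes len :: "int ^ 'd ^ 'd \<Rightarrow> real"
  assumes len_mult_le: "det A = 1 \<Longrightarrow> det B = 1 \<Longrightarrow> len (A ** B) \<le> len A + len B"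
    and ln_norm_le_len: "det A = 1 \<Longrightarrow> ln (SLZ_norm A) \<le> len A"
begin

lemma len_nonneg: "det A = 1 \<Longrightarrow> 0 \<le> len A"
  using ln_norm_le_len [of A] SLZ_norm_ge_1 [of A] by (smt (verit) ln_ge_zero)

text \<open>\<open>u a b\<close> carries the vector (a, b) in rows \<open>i\<close>,
  \<open>k\<close> of column \<open>j\<close>, and conjugation by
  \<open>?E i k 1 ** ?E k i 1\<close> applies (1 1; 0 1)(1 0; 1 1) = (2 1; 1 1) to it. The case
  \<open>n = 0\<close> is left out because \<open>ln 1 = 0\<close>, while the length of the identity
  need not vanish.\<close>

lemma len_transvection_le_single:
  assumes "CARD('d) \<ge> 3" "i \<noteq> j"
  shows "\<exists>C\<ge>0. \<forall>n. n \<noteq> 0 \<longrightarrow> len (transvection i j n) \<le> C * ln (1 + \<bar>real_of_int n\<bar>)"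
proof -
  have "\<exists>k. k \<notin> {i, j}"
  proof (rule ccontr)
    assume "\<not> ?thesis"
    then have "UNIV = {i, j}"
      by blast
    then have "CARD('d) \<le> 2"
      by (metis assms(2) card_2_iff order_refl)
    with assms(1) show False
      by simp
  qed
  then obtain k where k: "k \<noteq> i" "k \<noteq> j"
    by auto
  let ?E = transvection
  define u where "u a b = ?E i j a ** ?E k j b" for a b
  note E = u_def vec_eq_iff transvection_mult_nth transvection_nth matrix_mul_assoc [symmetric]
  have [simp]: "det (?E i j a) = 1" "det (?E k j a) = 1" "det (?E i k a) = 1" "det (?E k i a) = 1" for a
    using assms(2) k by (auto intro!: det_transvection)
  have u1 [simp]: "det (u a b) = 1" for a b
    by (simp add: u_def det_mul)
  \<comment> \<open>The same four transvections conjugate in either direction, so one constant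
    serves both H and its inverse.\<close>
  define c where "c = (len (?E i k 1) + len (?E k i 1)) + (len (?E k i (-1)) + len (?E i k (-1)))"
  define M where "M = (\<Sum>a\<in>{-4..4}. len (u a 0))"
  have len4: "len (P ** (Q ** (R ** (S ** T)))) \<le> len P + len Q + (len S + len T) + len R"
    if "det P = 1" "det Q = 1" "det R = 1" "det S = 1" "det T = 1" for P Q R S T
    using that len_mult_le [of P "Q ** (R ** (S ** T))"] len_mult_le [of Q "R ** (S ** T)"]
      len_mult_le [of R "S ** T"] len_mult_le [of S T]
    by (simp add: det_mul)
  have "u (a + a') (b + b') = u a b ** u a' b'" for a b a' b'
    using assms(2) k by (auto simp: E)
  then have add: "len (u (a + a') (b + b')) \<le> len (u a b) + len (u a' b')" for a b a' b'
    by (simp add: len_mult_le)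
  have "u (2 * a + b) (a + b) = ?E i k 1 ** (?E k i 1 ** (u a b ** (?E k i (-1) ** ?E i k (-1))))" for a b
    using assms(2) k by (auto simp: E)
  then have fwd: "len (u (2 * a + b) (a + b)) \<le> len (u a b) + c" for a b
    using len4 [of "?E i k 1" "?E k i 1" "u a b" "?E k i (-1)" "?E i k (-1)"] by (simp add: c_def)
  have "u (a - b) (2 * b - a) = ?E k i (-1) ** (?E i k (-1) ** (u a b ** (?E i k 1 ** ?E k i 1)))" for a b
    using assms(2) k by (auto simp: E)
  then have bwd: "len (u (a - b) (2 * b - a)) \<le> len (u a b) + c" for a b
    using len4 [of "?E k i (-1)" "?E i k (-1)" "u a b" "?E i k 1" "?E k i 1"] by (simp add: c_def)
  have small: "len (u a 0) \<le> M" if "\<bar>a\<bar> \<le> 4" for a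
    unfolding M_def using that by (intro member_le_sum) (auto intro: len_nonneg)
  have c: "0 \<le> c" and M: "0 \<le> M"
    unfolding c_def M_def by (auto intro!: add_nonneg_nonneg sum_nonneg len_nonneg)
  have "len (?E i j n) \<le> (7 / ln 2 * (c + M)) * ln (1 + \<bar>real_of_int n\<bar>)" if "n \<noteq> 0" for n
  proof -
    let ?r = "1 + \<bar>real_of_int n\<bar>"
    have "1 \<le> \<bar>real_of_int n\<bar>"
      using that by linarith
    then have r: "2 \<le> ?r"
      by simp
    define J where "J = nat \<lceil>log 2 ?r\<rceil>"
    have l: "1 \<le> log 2 ?r"
      using r by (simp add: le_log_iff)
    then have J: "log 2 ?r \<le> real J" "real J \<le> log 2 ?r + 1"
      unfolding J_def by linarith+
    have "?r \<le> 2 ^ J"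
      using J(1) r by (simp add: log_le_iff powr_realpow)
    then have "real_of_int \<bar>n\<bar> < real_of_int (2 ^ J)"
      by simp
    then have "\<bar>n\<bar> < 2 ^ J"
      by (simp only: of_int_less_iff)
    then have "len (u n 0) \<le> (2 * real J + 3) * (c + M)"
      using hyperbolic_length_bound [where L = "\<lambda>a b. len (u a b)", OF add fwd bwd small c] by blast
    \<comment> \<open>Since \<open>J\<close> exceeds the binary logarithm by at most 1, the factor
      is at most twice the logarithm plus 5; the logarithm is at least 1, whence 7.\<close>
    also have "\<dots> \<le> (7 * log 2 ?r) * (c + M)"
      by (rule mult_right_mono) (use J(2) l c M in linarith)+
    also have "u n 0 = ?E i j n"
      by (auto simp: E)
    finally show ?thesis
      by (simp add: log_def field_simps)
  qed
  moreover have "0 \<le> 7 / ln 2 * (c + M)"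
    using c M by auto
  ultimately show ?thesis
    by blast
qed

lemma len_transvection_le:
  assumes "CARD('d) \<ge> 3"
  obtains C where "0 \<le> C"
    "\<And>i j n. i \<noteq> j \<Longrightarrow> n \<noteq> 0 \<Longrightarrow> len (transvection i j n) \<le> C * ln (1 + \<bar>real_of_int n\<bar>)"
proof -
  have "\<forall>p. \<exists>C\<ge>0. fst p \<noteq> snd p \<longrightarrow>
      (\<forall>n. n \<noteq> 0 \<longrightarrow> len (transvection (fst p) (snd p) n) \<le> C * ln (1 + \<bar>real_of_int n\<bar>))"
    using len_transvection_le_single [OF assms] by (metis order_refl)
  then obtain C where C: "\<And>p. 0 \<le> C p" "\<And>p n. fst p \<noteq> snd p \<Longrightarrow> n \<noteq> 0 \<Longrightarrow>
      len (transvection (fst p) (snd p) n) \<le> C p * ln (1 + \<bar>real_of_int n\<bar>)"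
    by metis
  have "len (transvection i j n) \<le> (\<Sum>p\<in>UNIV. C p) * ln (1 + \<bar>real_of_int n\<bar>)"
    if "i \<noteq> j" "n \<noteq> 0" for i j n
  proof -
    have "len (transvection i j n) \<le> C (i, j) * ln (1 + \<bar>real_of_int n\<bar>)"
      using C(2) [of "(i, j)"] that by simp
    also have "\<dots> \<le> (\<Sum>p\<in>UNIV. C p) * ln (1 + \<bar>real_of_int n\<bar>)"
      using C(1) by (intro mult_right_mono member_le_sum) auto
    finally show ?thesis .
  qed
  with C(1) that [of "\<Sum>p\<in>UNIV. C p"] show ?thesis
    by (simp add: sum_nonneg)
qed

end

section \<open>Row reduction of logarithmic length\<close>

text \<open>Quantifying over all \<open>A\<close> makes closure under products immediate. The last
  clause is the trace of "rows \<open>i\<close> and \<open>j\<close> are combined only with each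
  other" that matters later: a column vanishing in both rows keeps doing so, which protects finished
  pivot columns.\<close>

definition two_row_op :: "'d \<Rightarrow> 'd \<Rightarrow> int ^ 'd ^ 'd \<Rightarrow> bool" where
  "two_row_op i j g \<longleftrightarrow> det g = 1 \<and>
     (\<forall>(A :: int ^ 'd ^ 'd) a b. a \<noteq> i \<longrightarrow> a \<noteq> j \<longrightarrow> (g ** A) $ a $ b = A $ a $ b) \<and>
     (\<forall>(A :: int ^ 'd ^ 'd) b. A $ i $ b = 0 \<longrightarrow> A $ j $ b = 0 \<longrightarrow> (g ** A) $ i $ b = 0 \<and> (g ** A) $ j $ b = 0)"

lemma two_row_op_one: "two_row_op i j (mat 1)"
  by (simp add: two_row_op_def)

lemma two_row_op_mult: "two_row_op i j g \<Longrightarrow> two_row_op i j h \<Longrightarrow> two_row_op i j (g ** h)"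
  by (simp add: two_row_op_def det_mul matrix_mul_assoc [symmetric])

lemma two_row_op_sym: "two_row_op i j g \<Longrightarrow> two_row_op j i g"
  by (simp add: two_row_op_def)

lemma two_row_op_transvection: "i \<noteq> j \<Longrightarrow> two_row_op i j (transvection i j n)"
  by (simp add: two_row_op_def det_transvection transvection_mult_nth)

text \<open>With remainder r one has |x| = |r| + |q| |y|, and |r| < |y| gives the product bound. In
  logarithms it says that ln(1 + |q|) is at most ln|x| - ln|r|. The bound of |q| by |x| is for exact
  division, where r has no logarithm.\<close>

lemma euclid_step:
  fixes x y :: int
  assumes "\<bar>y\<bar> \<le> \<bar>x\<bar>" "y \<noteq> 0"
  obtains q where "q \<noteq> 0" "\<bar>x - q * y\<bar> < \<bar>y\<bar>" "(1 + \<bar>q\<bar>) * \<bar>x - q * y\<bar> \<le> \<bar>x\<bar>" "\<bar>q\<bar> \<le> \<bar>x\<bar>"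
proof
  define m where "m = \<bar>x\<bar> div \<bar>y\<bar>"
  let ?q = "sgn x * sgn y * m"
  have m: "1 \<le> m"
    using assms by (simp add: m_def pos_imp_zdiv_pos_iff int_one_le_iff_zero_less)
  have "x \<noteq> 0"
    using assms by auto
  then have q: "\<bar>?q\<bar> = m"
    using m assms(2) by (simp add: abs_mult abs_sgn_eq)
  have "x - ?q * y = sgn x * (\<bar>x\<bar> - m * \<bar>y\<bar>)"
    by (simp add: right_diff_distrib sgn_mult_abs abs_sgn [of y] mult.assoc)
  also have "\<bar>x\<bar> - m * \<bar>y\<bar> = \<bar>x\<bar> mod \<bar>y\<bar>"
    unfolding m_def by (simp add: minus_div_mult_eq_mod)
  finally have r: "\<bar>x - ?q * y\<bar> = \<bar>x\<bar> mod \<bar>y\<bar>"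
    using \<open>x \<noteq> 0\<close> assms(2) by (simp add: abs_mult abs_sgn_eq)
  show "?q \<noteq> 0"
    using q m by auto
  show r_less: "\<bar>x - ?q * y\<bar> < \<bar>y\<bar>"
    unfolding r using assms(2) by simp
  have "(1 + m) * (\<bar>x\<bar> mod \<bar>y\<bar>) \<le> \<bar>x\<bar> mod \<bar>y\<bar> + m * \<bar>y\<bar>"
    using m r_less r by (simp add: distrib_right)
  also have "\<dots> = \<bar>x\<bar>"
    by (simp add: m_def)
  finally show "(1 + \<bar>?q\<bar>) * \<bar>x - ?q * y\<bar> \<le> \<bar>x\<bar>"
    unfolding q r .
  show "\<bar>?q\<bar> \<le> \<bar>x\<bar>"
  proof -
    have "m * 1 \<le> m * \<bar>y\<bar>"
      using m assms(2) by (intro mult_left_mono) auto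
    also have "\<dots> \<le> \<bar>x\<bar> mod \<bar>y\<bar> + m * \<bar>y\<bar>"
      using assms(2) by simp
    also have "\<dots> = \<bar>x\<bar>"
      by (simp add: m_def)
    finally show ?thesis
      unfolding q by simp
  qed
qed

section \<open>Euclidean elimination in two rows\<close>

context subadditive_length
begin

text \<open>Subadditivity does not force the identity to have length 0; this absorbs its length into
  \<open>ln X\<close>.\<close>

lemma len_one_le:
  assumes "2 \<le> X"
  shows "len (mat 1) \<le> len (mat 1) / ln 2 * ln X"
proof -
  have "len (mat 1) * ln 2 \<le> len (mat 1) * ln X"
    using assms len_nonneg [of "mat 1"] by (intro mult_left_mono) auto
  then show ?thesis
    by (simp add: field_simps)
qed

context
  fixes C :: real
  assumes C: "0 \<le> C"
    and transvection_le:
      "\<And>i j n. i \<noteq> j \<Longrightarrow> n \<noteq> 0 \<Longrightarrow> len (transvection i j n) \<le> C * ln (1 + \<bar>real_of_int n\<bar>)"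
begin

text \<open>The term \<open>ln 2\<close> pays for the final, exact division: a zero remainder leaves
  nothing to telescope with, but there 1 + |q| is at most 2|x|.\<close>

lemma euclid_two_rows:
  assumes "i \<noteq> j" "A $ i $ k \<noteq> 0" "A $ j $ k \<noteq> 0"
  shows "\<exists>g. two_row_op i j g \<and> ((g ** A) $ i $ k = 0 \<or> (g ** A) $ j $ k = 0) \<and>
    len g \<le> C * (ln \<bar>real_of_int (A $ i $ k)\<bar> + ln \<bar>real_of_int (A $ j $ k)\<bar> + ln 2)"
  using assms
proof (induction "nat (\<bar>A $ i $ k\<bar> + \<bar>A $ j $ k\<bar>)" arbitrary: i j A rule: less_induct)
  case less
  \<comment> \<open>The primed indices name the row with the larger entry first; both orders occur
    because the roles alternate between divisions.\<close>
  have *: ?case if i'j': "i' \<noteq> j'" "{i', j'} = {i, j}" and le: "\<bar>A $ j' $ k\<bar> \<le> \<bar>A $ i' $ k\<bar>" for i' j'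
  proof -
    have op: "two_row_op i' j' = two_row_op i j"
      using i'j' two_row_op_sym by (auto simp: doubleton_eq_iff fun_eq_iff)
    define x y where "x = A $ i' $ k" and "y = A $ j' $ k"
    have xy: "x \<noteq> 0" "y \<noteq> 0"
      using less.prems i'j'(2) by (auto simp: doubleton_eq_iff x_def y_def)
    have pot: "ln \<bar>real_of_int (A $ i $ k)\<bar> + ln \<bar>real_of_int (A $ j $ k)\<bar> =
        ln \<bar>real_of_int x\<bar> + ln \<bar>real_of_int y\<bar>"
      using i'j'(2) by (auto simp: doubleton_eq_iff x_def y_def)
    obtain q where q: "q \<noteq> 0" "\<bar>x - q * y\<bar> < \<bar>y\<bar>" "(1 + \<bar>q\<bar>) * \<bar>x - q * y\<bar> \<le> \<bar>x\<bar>" "\<bar>q\<bar> \<le> \<bar>x\<bar>"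
      using euclid_step [of y x] le xy unfolding x_def y_def by metis
    let ?T = "transvection i' j' (- q)"
    define B where "B = ?T ** A"
    have B: "B $ i' $ k = x - q * y" "B $ j' $ k = y"
      using i'j'(1) by (simp_all add: B_def transvection_mult_nth x_def y_def)
    have T: "two_row_op i' j' ?T" "len ?T \<le> C * ln (1 + \<bar>real_of_int q\<bar>)"
      using two_row_op_transvection transvection_le [of i' j' "- q"] i'j'(1) q(1) by auto
    have y1: "0 \<le> ln \<bar>real_of_int y\<bar>"
      using xy by (intro ln_ge_zero) linarith
    show ?thesis
    proof (cases "x - q * y = 0")
      case True
      have "1 + \<bar>real_of_int q\<bar> \<le> 2 * \<bar>real_of_int x\<bar>"
        using q(4) xy(1) by linarith
      then have "ln (1 + \<bar>real_of_int q\<bar>) \<le> ln (2 * \<bar>real_of_int x\<bar>)"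
        by (subst ln_le_cancel_iff) auto
      also have "\<dots> \<le> ln \<bar>real_of_int x\<bar> + ln \<bar>real_of_int y\<bar> + ln 2"
        using xy y1 by (simp add: ln_mult)
      finally have "len ?T \<le> C * (ln \<bar>real_of_int x\<bar> + ln \<bar>real_of_int y\<bar> + ln 2)"
        using T(2) C by (meson mult_left_mono order_trans)
      moreover have "(?T ** A) $ i' $ k = 0"
        using True B by (simp add: B_def)
      ultimately show ?thesis
        using T(1) i'j'(2) unfolding op pot by (auto simp: doubleton_eq_iff)
    next
      case False
      have "nat (\<bar>B $ i' $ k\<bar> + \<bar>B $ j' $ k\<bar>) < nat (\<bar>A $ i' $ k\<bar> + \<bar>A $ j' $ k\<bar>)"
        unfolding B using q(2) le xy by (simp add: x_def y_def)
      also have "\<bar>A $ i' $ k\<bar> + \<bar>A $ j' $ k\<bar> = \<bar>A $ i $ k\<bar> + \<bar>A $ j $ k\<bar>"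
        using i'j'(2) by (auto simp: doubleton_eq_iff)
      finally obtain g where g: "two_row_op i' j' g"
          "(g ** B) $ i' $ k = 0 \<or> (g ** B) $ j' $ k = 0"
          "len g \<le> C * (ln \<bar>real_of_int (x - q * y)\<bar> + ln \<bar>real_of_int y\<bar> + ln 2)"
        using less.hyps [of B i' j'] i'j'(1) False xy unfolding B by auto
      have pos: "0 < \<bar>real_of_int (x - q * y)\<bar>"
        using False by (simp only: zero_less_abs_iff of_int_eq_0_iff not_False_eq_True)
      have "real_of_int ((1 + \<bar>q\<bar>) * \<bar>x - q * y\<bar>) \<le> real_of_int \<bar>x\<bar>"
        using q(3) by (simp only: of_int_le_iff)
      then have "ln ((1 + \<bar>real_of_int q\<bar>) * \<bar>real_of_int (x - q * y)\<bar>) \<le> ln \<bar>real_of_int x\<bar>"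
        using pos xy by (subst ln_le_cancel_iff) (auto intro!: mult_pos_pos simp del: of_int_diff)
      then have "ln (1 + \<bar>real_of_int q\<bar>) + ln \<bar>real_of_int (x - q * y)\<bar> \<le> ln \<bar>real_of_int x\<bar>"
        using pos by (subst (asm) ln_mult_pos) auto
      then have "C * (ln (1 + \<bar>real_of_int q\<bar>) + ln \<bar>real_of_int (x - q * y)\<bar>) \<le> C * ln \<bar>real_of_int x\<bar>"
        using C by (rule mult_left_mono)
      moreover have "len (g ** ?T) \<le> len g + len ?T"
        using g(1) T(1) by (auto intro: len_mult_le simp: two_row_op_def)
      ultimately have "len (g ** ?T) \<le> C * (ln \<bar>real_of_int x\<bar> + ln \<bar>real_of_int y\<bar> + ln 2)"
        using g(3) T(2) by (simp add: distrib_left)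
      moreover have "two_row_op i j (g ** ?T)"
        using two_row_op_mult [OF g(1) T(1)] by (simp add: op)
      moreover have "((g ** ?T) ** A) $ i $ k = 0 \<or> ((g ** ?T) ** A) $ j $ k = 0"
        using g(2) i'j'(2) by (auto simp: B_def matrix_mul_assoc doubleton_eq_iff)
      ultimately show ?thesis
        unfolding pot by blast
    qed
  qed
  show ?case
    using *[of i j] *[of j i] less.prems by (cases "\<bar>A $ j $ k\<bar> \<le> \<bar>A $ i $ k\<bar>") auto
qed

text \<open>In column \<open>k\<close> the two transvections turn (0, y) into (y, y) and then into
  (y, 0), an exchange that keeps the determinant 1.\<close>

lemma swap_rows:
  assumes "i \<noteq> j" "A $ i $ k = 0 \<or> A $ j $ k = 0"
  shows "\<exists>g. two_row_op i j g \<and> (g ** A) $ j $ k = 0 \<and> len g \<le> len (mat 1) + 2 * C * ln 2"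
proof (cases "A $ j $ k = 0")
  case True
  with C show ?thesis
    by (intro exI [of _ "mat 1"]) (auto simp: two_row_op_one)
next
  case False
  let ?T = "transvection i j 1" and ?U = "transvection j i (-1)"
  have TU: "two_row_op i j ?T" "two_row_op i j ?U"
    using assms(1) two_row_op_transvection two_row_op_sym by metis+
  then have "len (?U ** ?T) \<le> len ?U + len ?T"
    by (intro len_mult_le) (auto simp: two_row_op_def)
  also have "\<dots> \<le> len (mat 1) + 2 * C * ln 2"
    using transvection_le [of i j 1] transvection_le [of j i "-1"] assms(1) len_nonneg [of "mat 1"] by auto
  finally have "len (?U ** ?T) \<le> len (mat 1) + 2 * C * ln 2" .
  moreover have "(?U ** ?T ** A) $ j $ k = 0"
    using assms False by (auto simp: matrix_mul_assoc [symmetric] transvection_mult_nth)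
  ultimately show ?thesis
    using two_row_op_mult [OF TU(2,1)] by blast
qed

lemma clear_entry:
  assumes "i \<noteq> j" "2 \<le> X" "SLZ_norm A \<le> X"
  shows "\<exists>g. two_row_op i j g \<and> (g ** A) $ j $ k = 0 \<and> len g \<le> (5 * C + 2 * len (mat 1) / ln 2) * ln X"
proof -
  have X: "ln 2 \<le> ln X"
    using assms(2) by (subst ln_le_cancel_iff) auto
  have entry: "ln \<bar>real_of_int (A $ a $ k)\<bar> \<le> ln X" if "A $ a $ k \<noteq> 0" for a
    using that assms(2) order_trans [OF abs_nth_le_SLZ_norm assms(3), of a k]
    by (subst ln_le_cancel_iff) auto
  obtain g where g: "two_row_op i j g" "(g ** A) $ i $ k = 0 \<or> (g ** A) $ j $ k = 0"
      "len g \<le> 3 * C * ln X + len (mat 1)"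
  proof (cases "A $ i $ k = 0 \<or> A $ j $ k = 0")
    case True
    moreover have "0 \<le> C * ln X"
      using C assms(2) by simp
    ultimately show ?thesis
      by (intro that [of "mat 1"]) (auto simp: two_row_op_one)
  next
    case False
    then obtain g where g: "two_row_op i j g" "(g ** A) $ i $ k = 0 \<or> (g ** A) $ j $ k = 0"
      "len g \<le> C * (ln \<bar>real_of_int (A $ i $ k)\<bar> + ln \<bar>real_of_int (A $ j $ k)\<bar> + ln 2)"
      using euclid_two_rows [OF assms(1)] by blast
    note g(3)
    also have "C * (ln \<bar>real_of_int (A $ i $ k)\<bar> + ln \<bar>real_of_int (A $ j $ k)\<bar> + ln 2) \<le> C * (3 * ln X)"
      using False C X entry [of i] entry [of j] by (intro mult_left_mono) auto
    finally show ?thesis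
      using that [OF g(1,2)] len_nonneg [of "mat 1"] by simp
  qed
  obtain h where h: "two_row_op i j h" "(h ** (g ** A)) $ j $ k = 0" "len h \<le> len (mat 1) + 2 * C * ln 2"
    using swap_rows [OF assms(1) g(2)] by blast
  have "len (h ** g) \<le> len h + len g"
    using g(1) h(1) by (auto intro: len_mult_le simp: two_row_op_def)
  \<comment> \<open>Euclid contributes \<open>3 * C * ln X\<close>, from two entries of size at most
    \<open>X\<close> and from \<open>ln 2\<close>, and the exchange contributes
    \<open>2 * C * ln 2\<close>. Either may be replaced by the identity, hence two copies of
    \<open>len (mat 1)\<close>.\<close>
  also have "\<dots> \<le> 3 * C * ln X + 2 * C * ln 2 + 2 * len (mat 1)"
    using g(3) h(3) by simp
  also have "\<dots> \<le> 3 * C * ln X + 2 * C * ln X + 2 * (len (mat 1) / ln 2 * ln X)"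
    using X C len_one_le [OF assms(2)] by (intro add_mono mult_left_mono) auto
  finally have "len (h ** g) \<le> (5 * C + 2 * len (mat 1) / ln 2) * ln X"
    by (simp add: algebra_simps)
  with two_row_op_mult [OF h(1) g(1)] h(2) show ?thesis
    by (auto simp: matrix_mul_assoc)
qed

end

text \<open>\<open>X\<close> bounds the norm instead of being the norm, so that it can be kept at
  least 2 and replaced by a power when reductions are composed. The constant is chosen before the
  matrix.\<close>

definition reaches :: "(int ^ 'd ^ 'd \<Rightarrow> bool) \<Rightarrow> (int ^ 'd ^ 'd \<Rightarrow> bool) \<Rightarrow> bool" where
  "reaches P Q \<longleftrightarrow> (\<exists>c\<ge>0. \<forall>A X. det A = 1 \<longrightarrow> P A \<longrightarrow> 2 \<le> X \<longrightarrow> SLZ_norm A \<le> X \<longrightarrow>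
     (\<exists>g. det g = 1 \<and> Q (g ** A) \<and> len g \<le> c * ln X))"

lemma reachesI:
  assumes "0 \<le> c" "\<And>A X. det A = 1 \<Longrightarrow> P A \<Longrightarrow> 2 \<le> X \<Longrightarrow> SLZ_norm A \<le> X \<Longrightarrow>
     \<exists>g. det g = 1 \<and> Q (g ** A) \<and> len g \<le> c * ln X"
  shows "reaches P Q"
  using assms unfolding reaches_def by blast

lemma reaches_imp:
  assumes "\<And>A. det A = 1 \<Longrightarrow> P A \<Longrightarrow> Q A"
  shows "reaches P Q"
proof (rule reachesI)
  show "0 \<le> len (mat 1) / ln 2"
    using len_nonneg [of "mat 1"] by simp
qed (use assms len_one_le in \<open>force intro: exI [of _ "mat 1"]\<close>)

text \<open>A move of length at most c ln X has norm at most X^c, so the second reduction starts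
  from norm at most X^(c+1) and costs at most d (c+1) ln X. The constants compound, which is
  harmless because the dimension fixes the number of stages.\<close>

lemma reaches_trans:
  assumes "reaches P Q" "reaches Q R"
  shows "reaches P R"
proof -
  obtain c where c: "0 \<le> c" "\<And>A X. det A = 1 \<Longrightarrow> P A \<Longrightarrow> 2 \<le> X \<Longrightarrow> SLZ_norm A \<le> X \<Longrightarrow>
     \<exists>g. det g = 1 \<and> Q (g ** A) \<and> len g \<le> c * ln X"
    using assms(1) unfolding reaches_def by blast
  obtain d where d: "0 \<le> d" "\<And>A X. det A = 1 \<Longrightarrow> Q A \<Longrightarrow> 2 \<le> X \<Longrightarrow> SLZ_norm A \<le> X \<Longrightarrow>
     \<exists>g. det g = 1 \<and> R (g ** A) \<and> len g \<le> d * ln X"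
    using assms(2) unfolding reaches_def by blast
  show ?thesis
  proof (rule reachesI)
    show "0 \<le> c + d * (c + 1)"
      using c(1) d(1) by simp
    fix A X
    assume A: "det A = 1" "P A" "2 \<le> X" "SLZ_norm A \<le> X"
    then obtain g where g: "det g = 1" "Q (g ** A)" "len g \<le> c * ln X"
      using c(2) by blast
    have "ln (SLZ_norm g) \<le> c * ln X"
      using ln_norm_le_len [OF g(1)] g(3) by simp
    then have "SLZ_norm g \<le> X powr c"
      using A(3) SLZ_norm_ge_1 [OF g(1)] by (simp add: powr_def) (metis exp_le_cancel_iff exp_ln less_le_trans zero_less_one)
    then have "SLZ_norm (g ** A) \<le> X powr c * X"
      using A SLZ_norm_mult_le [of g A] SLZ_norm_ge_1 [OF A(1)]
      by (smt (verit) mult_mono powr_ge_zero)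
    then have N: "SLZ_norm (g ** A) \<le> X powr (c + 1)"
      using A(3) by (simp add: powr_add)
    have "2 \<le> X powr (c + 1)"
      using A(3) c(1) powr_mono [of 1 "c + 1" X] by simp
    then obtain h where h: "det h = 1" "R (h ** (g ** A))" "len h \<le> d * ln (X powr (c + 1))"
      using d(2) [OF _ g(2) _ N] A(1) g(1) by (metis det_mul mult_1)
    have "len (h ** g) \<le> len h + len g"
      using g h by (intro len_mult_le)
    also have "\<dots> \<le> (c + d * (c + 1)) * ln X"
      using g(3) h(3) A(3) by (simp add: ln_powr algebra_simps)
    finally show "\<exists>g. det g = 1 \<and> R (g ** A) \<and> len g \<le> (c + d * (c + 1)) * ln X"
      using g(1) h(1,2) by (intro exI [of _ "h ** g"]) (auto simp: det_mul matrix_mul_assoc)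
  qed
qed

end

text \<open>Only columns are prescribed: a pivot row may still have arbitrary entries in other
  columns. For \<open>S = UNIV\<close> just a diagonal of units remains.\<close>

definition pivots :: "'d set \<Rightarrow> int ^ 'd ^ 'd \<Rightarrow> bool" where
  "pivots S A \<longleftrightarrow> (\<forall>s\<in>S. \<bar>A $ s $ s\<bar> = 1 \<and> (\<forall>a. a \<noteq> s \<longrightarrow> A $ a $ s = 0))"

definition pivots_cleared :: "'d set \<Rightarrow> 'd \<Rightarrow> 'd set \<Rightarrow> int ^ 'd ^ 'd \<Rightarrow> bool" where
  "pivots_cleared S k T A \<longleftrightarrow> pivots S A \<and> (\<forall>a\<in>T. A $ a $ k = 0)"

text \<open>Row \<open>k\<close> of the inverse vanishes at the pivots, so its product with column \<open>k\<close> has a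
  single term.\<close>

lemma pivot_unit:
  fixes A :: "int ^ 'd ^ 'd"
  assumes "det A = 1" "pivots_cleared S k T A" "k \<notin> S" "- insert k S \<subseteq> T"
  shows "\<bar>A $ k $ k\<bar> = 1"
proof -
  obtain B where B: "B ** A = mat 1"
    using SLZ_left_inverse [OF assms(1)] by blast
  have prod: "(\<Sum>a\<in>UNIV. B $ k $ a * A $ a $ b) = of_bool (k = b)" for b
    using B by (simp add: matrix_matrix_mult_def mat_def vec_eq_iff)
  have "B $ k $ s = 0" if s: "s \<in> S" for s
  proof -
    have "(\<Sum>a\<in>UNIV. B $ k $ a * A $ a $ s) = (\<Sum>a\<in>UNIV. if a = s then B $ k $ s * A $ s $ s else 0)"
      using assms(2) s by (intro sum.cong) (auto simp: pivots_cleared_def pivots_def)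
    moreover have "k \<noteq> s"
      using assms(3) s by auto
    ultimately have "B $ k $ s * A $ s $ s = 0"
      using prod [of s] by simp
    then show ?thesis
      using assms(2) s by (auto simp: pivots_cleared_def pivots_def)
  qed
  moreover have "A $ a $ k = 0" if "a \<noteq> k" "a \<notin> S" for a
    using that assms(2,4) by (auto simp: pivots_cleared_def)
  ultimately have "(\<Sum>a\<in>UNIV. B $ k $ a * A $ a $ k) = (\<Sum>a\<in>UNIV. if a = k then B $ k $ k * A $ k $ k else 0)"
    by (intro sum.cong) auto
  then have "B $ k $ k * A $ k $ k = 1"
    using prod [of k] by simp
  then show ?thesis
    by (auto simp: zmult_eq_1_iff)
qed

section \<open>Creating pivots column by column\<close>

context subadditive_length
begin

text \<open>Neither row involved is a pivot row, so the columns in \<open>S\<close> vanish in both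
  and survive the whole Euclidean algorithm.\<close>

lemma reaches_clear_row:
  assumes "CARD('d) \<ge> 3" "k \<notin> S" "k \<notin> T" "j \<noteq> k" "j \<notin> S"
  shows "reaches (pivots_cleared S k T) (pivots_cleared S k (insert j T))"
proof -
  obtain C where C: "0 \<le> C"
    "\<And>i j n. i \<noteq> j \<Longrightarrow> n \<noteq> 0 \<Longrightarrow> len (transvection i j n) \<le> C * ln (1 + \<bar>real_of_int n\<bar>)"
    using len_transvection_le [OF assms(1)] by blast
  show ?thesis
  proof (rule reachesI)
    show "0 \<le> 5 * C + 2 * len (mat 1) / ln 2"
      using C(1) len_nonneg [of "mat 1"] by simp
    fix A X
    assume A: "det A = 1" "pivots_cleared S k T A" "2 \<le> X" "SLZ_norm A \<le> X"
    then obtain g where g: "two_row_op k j g" "(g ** A) $ j $ k = 0"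
        "len g \<le> (5 * C + 2 * len (mat 1) / ln 2) * ln X"
      using clear_entry [OF C, of k j X A k] assms(4) by blast
    have other: "(g ** A) $ a $ b = A $ a $ b" if "a \<noteq> k" "a \<noteq> j" for a b
      using g(1) that by (simp add: two_row_op_def)
    have "(g ** A) $ k $ s = 0" "(g ** A) $ j $ s = 0" if "s \<in> S" for s
      using that g(1) A(2) assms(2,5) unfolding two_row_op_def pivots_cleared_def pivots_def by metis+
    then have "(g ** A) $ a $ s = 0" if "s \<in> S" "a \<noteq> s" for a s
      using that A(2) other by (cases "a = k \<or> a = j") (auto simp: pivots_cleared_def pivots_def)
    moreover have "\<bar>(g ** A) $ s $ s\<bar> = 1" if "s \<in> S" for s
      using that A(2) other [of s s] assms(2,5) by (metis pivots_cleared_def pivots_def)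
    moreover have "(g ** A) $ a $ k = 0" if "a \<in> insert j T" for a
      using that A(2) other [of a k] assms(3) g(2) by (cases "a = j") (auto simp: pivots_cleared_def)
    ultimately have "pivots_cleared S k (insert j T) (g ** A)"
      by (auto simp: pivots_cleared_def pivots_def)
    then show "\<exists>g. det g = 1 \<and> pivots_cleared S k (insert j T) (g ** A) \<and>
        len g \<le> (5 * C + 2 * len (mat 1) / ln 2) * ln X"
      using g by (auto simp: two_row_op_def)
  qed
qed

text \<open>Euclid on rows \<open>k\<close> and \<open>j\<close> could destroy the pivot of row
  \<open>j\<close>. Once column \<open>k\<close> is cleared outside \<open>insert k S\<close>, its
  diagonal entry is a unit, and a single multiple of row \<open>k\<close> clears the entry; row
  \<open>k\<close> vanishes on the columns in \<open>S\<close>, so all pivots survive.\<close>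

lemma reaches_clear_pivot_row:
  assumes "CARD('d) \<ge> 3" "k \<notin> S" "- insert k S \<subseteq> T" "k \<notin> T" "j \<in> S"
  shows "reaches (pivots_cleared S k T) (pivots_cleared S k (insert j T))"
proof -
  obtain C where C: "0 \<le> C"
    "\<And>i j n. i \<noteq> j \<Longrightarrow> n \<noteq> 0 \<Longrightarrow> len (transvection i j n) \<le> C * ln (1 + \<bar>real_of_int n\<bar>)"
    using len_transvection_le [OF assms(1)] by blast
  show ?thesis
  proof (rule reachesI)
    show "0 \<le> len (mat 1) / ln 2 + C * 2"
      using C(1) len_nonneg [of "mat 1"] by simp
    fix A X
    assume A: "det A = 1" "pivots_cleared S k T A" "2 \<le> X" "SLZ_norm A \<le> X"
    have jk: "j \<noteq> k"
      using assms(2,5) by auto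
    show "\<exists>g. det g = 1 \<and> pivots_cleared S k (insert j T) (g ** A) \<and>
        len g \<le> (len (mat 1) / ln 2 + C * 2) * ln X"
    proof (cases "A $ j $ k = 0")
      case True
      have "0 \<le> C * 2 * ln X"
        using C(1) A(3) by simp
      then have "len (mat 1) \<le> (len (mat 1) / ln 2 + C * 2) * ln X"
        using len_one_le [OF A(3)] by (simp add: distrib_right)
      with True A(2) show ?thesis
        by (intro exI [of _ "mat 1"]) (auto simp: pivots_cleared_def)
    next
      case False
      let ?n = "- (A $ j $ k * A $ k $ k)"
      let ?g = "transvection j k ?n"
      have zero: "A $ k $ s = 0" if "s \<in> S" for s
        using that A(2) assms(2) unfolding pivots_cleared_def pivots_def by metis
      have unit: "\<bar>A $ k $ k\<bar> = 1"
        using pivot_unit A(1,2) assms(2,3) by blast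
      have "1 + \<bar>real_of_int ?n\<bar> = 1 + \<bar>real_of_int (A $ j $ k)\<bar>"
        using unit by (simp add: abs_mult flip: of_int_abs)
      also have "\<dots> \<le> 2 * X"
        using order_trans [OF abs_nth_le_SLZ_norm A(4), of j k] A(3) by simp
      \<comment> \<open>Passing to the square of \<open>X\<close> is the origin of the 2 in
        \<open>C * 2\<close>.\<close>
      also have "\<dots> \<le> X * X"
        using A(3) by (intro mult_right_mono) auto
      finally have "ln (1 + \<bar>real_of_int ?n\<bar>) \<le> ln (X * X)"
        using A(3) by (subst ln_le_cancel_iff) auto
      then have "C * ln (1 + \<bar>real_of_int ?n\<bar>) \<le> C * (2 * ln X)"
        using A(3) C(1) by (intro mult_left_mono) (auto simp: ln_mult)
      then have "len ?g \<le> C * 2 * ln X"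
        using C(2) [of j k ?n] jk False unit by (cases "A $ k $ k = 0") auto
      moreover have "0 \<le> len (mat 1) / ln 2 * ln X"
        using len_nonneg [of "mat 1"] A(3) by simp
      ultimately have "len ?g \<le> (len (mat 1) / ln 2 + C * 2) * ln X"
        by (simp add: distrib_right)
      moreover have "A $ k $ k * A $ k $ k = 1"
        using unit by (auto simp: abs_if split: if_splits)
      then have "(?g ** A) $ j $ k = 0"
        by (simp add: transvection_mult_nth mult.assoc)
      then have "pivots_cleared S k (insert j T) (?g ** A)"
        using A(2) zero unfolding pivots_cleared_def pivots_def
        by (auto simp: transvection_mult_nth)
      ultimately show ?thesis
        using det_transvection [OF jk] by blast
    qed
  qed
qed

lemma reaches_insert_pivot:
  assumes "CARD('d) \<ge> 3" "k \<notin> S"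
  shows "reaches (pivots S) (pivots (insert k S))"
proof -
  have "reaches (pivots S) (pivots_cleared S k T)" if "T \<subseteq> - insert k S" for T
    using finite [of T] that
  proof (induction T)
    case empty
    show ?case
      by (rule reaches_imp) (simp add: pivots_cleared_def)
  next
    case (insert j T)
    then show ?case
      using reaches_trans reaches_clear_row [OF assms, of T j] by auto
  qed
  moreover have "reaches (pivots_cleared S k (- insert k S)) (pivots_cleared S k (- insert k S \<union> T))"
    if "T \<subseteq> S" for T
    using finite [of T] that
  proof (induction T)
    case empty
    show ?case
      by (rule reaches_imp) simp
  next
    case (insert j T)
    then show ?case
      using reaches_trans reaches_clear_pivot_row [OF assms, of "- insert k S \<union> T" j] assms(2) by auto
  qed
  ultimately have "reaches (pivots S) (pivots_cleared S k (- insert k S \<union> S))"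
    using reaches_trans by blast
  moreover have "reaches (pivots_cleared S k (- insert k S \<union> S)) (pivots (insert k S))"
  proof (rule reaches_imp)
    fix A :: "int ^ 'd ^ 'd"
    assume A: "det A = 1" "pivots_cleared S k (- insert k S \<union> S) A"
    then have "\<bar>A $ k $ k\<bar> = 1"
      using pivot_unit assms(2) by blast
    with A(2) show "pivots (insert k S) A"
      by (auto simp: pivots_cleared_def pivots_def)
  qed
  ultimately show ?thesis
    by (rule reaches_trans)
qed

text \<open>The reduction gives \<open>g ** A = D\<close> with \<open>D\<close> in a finite set, so
  the inverse of \<open>A\<close> is \<open>I D ** g\<close>. Stating the bound for the inverse
  avoids inverting \<open>g\<close>: an abstract \<open>len\<close> is not assumed to control
  inverses.\<close>

theorem len_inverse_le_ln_norm:
  assumes "CARD('d) \<ge> 3"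
  obtains K where "0 \<le> K" "\<And>A B X. det A = 1 \<Longrightarrow> det B = 1 \<Longrightarrow> B ** A = mat 1 \<Longrightarrow>
    2 \<le> X \<Longrightarrow> SLZ_norm A \<le> X \<Longrightarrow> len B \<le> K * ln X"
proof -
  have "reaches (\<lambda>_. True) (pivots S)" for S
    using finite [of S]
  proof (induction S)
    case empty
    show ?case
      by (rule reaches_imp) (simp add: pivots_def)
  next
    case (insert k S)
    then show ?case
      using reaches_trans reaches_insert_pivot [OF assms] by blast
  qed
  then obtain c where c: "0 \<le> c" "\<And>A X. det A = 1 \<Longrightarrow> 2 \<le> X \<Longrightarrow> SLZ_norm A \<le> X \<Longrightarrow>
     \<exists>g. det g = 1 \<and> pivots UNIV (g ** A) \<and> len g \<le> c * ln X"
    unfolding reaches_def by blast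
  obtain I :: "int ^ 'd ^ 'd \<Rightarrow> int ^ 'd ^ 'd" where I: "\<And>A. det A = 1 \<Longrightarrow> det (I A) = 1 \<and> I A ** A = mat 1"
    using SLZ_left_inverse by metis
  define F where "F = {D :: int ^ 'd ^ 'd. det D = 1 \<and> pivots UNIV D}"
  have "\<bar>D $ a $ b\<bar> \<le> 1" if "pivots UNIV D" for D :: "int ^ 'd ^ 'd" and a b
    using that by (cases "a = b") (auto simp: pivots_def)
  then have "finite F"
    by (intro finite_subset [OF _ finite_bounded_int_matrices [of 1]]) (auto simp: F_def)
  define M where "M = (\<Sum>D\<in>F. len (I D))"
  have M: "0 \<le> M"
    unfolding M_def F_def using I by (intro sum_nonneg len_nonneg) auto
  show ?thesis
  proof
    show "0 \<le> M / ln 2 + c"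
      using M c(1) by simp
    fix A B :: "int ^ 'd ^ 'd" and X
    assume AB: "det A = 1" "det B = 1" "B ** A = mat 1" and X: "2 \<le> X" "SLZ_norm A \<le> X"
    then obtain g where g: "det g = 1" "pivots UNIV (g ** A)" "len g \<le> c * ln X"
      using c(2) by blast
    let ?D = "g ** A"
    have D: "?D \<in> F"
      using g AB by (simp add: F_def det_mul)
    then have ID: "det (I ?D) = 1" "I ?D ** ?D = mat 1"
      using I by (auto simp: F_def)
    \<comment> \<open>Both are inverse to \<open>B\<close>, \<open>A\<close> on the right and
      \<open>I B\<close> on the left; this makes \<open>B\<close> a two-sided inverse of
      \<open>A\<close>.\<close>
    have "A = I B"
      using I [OF AB(2)] AB(3) by (metis matrix_mul_assoc matrix_mul_lid matrix_mul_rid)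
    then have "A ** B = mat 1"
      using I [OF AB(2)] by simp
    then have "B = I ?D ** g"
      using ID(2) by (metis matrix_mul_assoc matrix_mul_lid matrix_mul_rid)
    then have "len B \<le> len (I ?D) + len g"
      using len_mult_le ID(1) g(1) by simp
    also have "len (I ?D) \<le> M"
      unfolding M_def using D \<open>finite F\<close> I by (intro member_le_sum len_nonneg) (auto simp: F_def)
    also have "M \<le> M / ln 2 * ln X"
      using M X(1) by (simp add: field_simps mult_left_mono)
    finally show "len B \<le> (M / ln 2 + c) * ln X"
      using g(3) by (simp add: distrib_right)
  qed
qed

end

section \<open>Word length in the projective group\<close>

abbreviation PSLZ_class :: "int ^ 'd ^ 'd \<Rightarrow> (int ^ 'd ^ 'd) set" where
  "PSLZ_class A \<equiv> SLZ_scalars #>\<^bsub>SLZ\<^esub> A"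

lemma PSLZ_class_in_carrier: "det A = 1 \<Longrightarrow> PSLZ_class A \<in> carrier PSLZ"
  by (auto simp: PSLZ_def FactGroup_def RCOSETS_def)

lemma PSLZ_class_mult:
  assumes "det A = 1" "det B = 1"
  shows "PSLZ_class (A ** B) = PSLZ_class A \<otimes>\<^bsub>PSLZ\<^esub> PSLZ_class B"
  using normal.rcos_sum [OF normal_SLZ_scalars, of A B] assms
  by (simp add: PSLZ_def FactGroup_def)

lemma PSLZ_class_one: "PSLZ_class (mat 1) = \<one>\<^bsub>PSLZ\<^esub>"
proof -
  interpret normal "SLZ_scalars :: (int ^ 'd ^ 'd) set" SLZ
    by (rule normal_SLZ_scalars)
  show ?thesis
    using coset_mult_one [OF subset] by (simp add: PSLZ_def FactGroup_def)
qed

lemma PSLZ_class_cases: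
  fixes \<gamma> :: "(int ^ 'd ^ 'd) set"
  assumes "\<gamma> \<in> carrier PSLZ"
  obtains A where "det A = 1" "\<gamma> = PSLZ_class A" "PSLZ_norm \<gamma> = SLZ_norm A"
proof -
  obtain A :: "int ^ 'd ^ 'd" where A: "det A = 1" "\<gamma> = PSLZ_class A"
    using assms by (auto simp: PSLZ_def FactGroup_def RCOSETS_def)
  moreover have "A \<in> \<gamma>"
    using A group.rcos_self [OF group_SLZ, of A SLZ_scalars]
      normal_imp_subgroup [OF normal_SLZ_scalars] by simp
  ultimately show ?thesis
    using that PSLZ_norm_coset [OF assms] by blast
qed

text \<open>Integer matrices of bounded norm are finite in number, so norms above 1 cannot
  accumulate at 1. This converts an additive constant into a multiple of the logarithm.\<close>

lemma SLZ_norm_gap: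
  obtains \<delta> where "0 < \<delta>" "\<And>A :: int ^ 'd ^ 'd. 1 < SLZ_norm A \<Longrightarrow> \<delta> \<le> ln (SLZ_norm A)"
proof -
  let ?F = "{A :: int ^ 'd ^ 'd. 1 < SLZ_norm A \<and> SLZ_norm A \<le> 2}"
  have "\<bar>A $ i $ j\<bar> \<le> 2" if "SLZ_norm A \<le> 2" for A :: "int ^ 'd ^ 'd" and i j
    using order_trans [OF abs_nth_le_SLZ_norm that, of i j] by linarith
  then have F: "finite ?F"
    by (intro finite_subset [OF _ finite_bounded_int_matrices [of 2]]) auto
  let ?L = "insert (ln 2) ((\<lambda>A. ln (SLZ_norm A)) ` ?F)"
  show ?thesis
  proof
    show "0 < Min ?L"
      using F by (subst Min_gr_iff) auto
    fix A :: "int ^ 'd ^ 'd"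
    assume A: "1 < SLZ_norm A"
    show "Min ?L \<le> ln (SLZ_norm A)"
    proof (cases "SLZ_norm A \<le> 2")
      case True
      with A F show ?thesis
        by (intro Min_le) auto
    next
      case False
      have "Min ?L \<le> ln 2"
        using F by (intro Min_le) auto
      also have "\<dots> \<le> ln (SLZ_norm A)"
        using False by simp
      finally show ?thesis .
    qed
  qed
qed

theorem theorem4p4p1:
  fixes \<Sigma> :: "(int ^ 'd ^ 'd) set set"
  assumes "CARD('d) \<ge> 3"
    and "finite \<Sigma>" and "\<Sigma> \<subseteq> carrier PSLZ" and "generate PSLZ \<Sigma> = carrier PSLZ"
  shows "\<exists>K>0. \<forall>\<gamma>\<in>carrier PSLZ. \<gamma> = \<one>\<^bsub>PSLZ\<^esub> \<or> PSLZ_norm \<gamma> > 1 \<longrightarrow>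
           real (word_dist PSLZ \<Sigma> \<one>\<^bsub>PSLZ\<^esub> \<gamma>) \<le> K * ln (PSLZ_norm \<gamma>)"
proof -
  interpret P: group "PSLZ :: (int ^ 'd ^ 'd) set monoid"
    by (rule group_PSLZ)
  let ?W = "word_dist PSLZ \<Sigma> \<one>\<^bsub>PSLZ\<^esub>"
  \<comment> \<open>Adding the logarithm of the norm to the word length makes the required
    domination of \<open>ln (SLZ_norm A)\<close> automatic and keeps subadditivity. As it is
    nonnegative, a bound for the sum still bounds the word length.\<close>
  interpret subadditive_length "\<lambda>A. real (?W (PSLZ_class A)) + ln (SLZ_norm A)"
  proof
    fix A B :: "int ^ 'd ^ 'd"
    assume A: "det A = 1"
    show "ln (SLZ_norm A) \<le> real (?W (PSLZ_class A)) + ln (SLZ_norm A)"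
      by simp
    assume B: "det B = 1"
    have "?W (PSLZ_class (A ** B)) \<le> ?W (PSLZ_class A) + ?W (PSLZ_class B)"
      using A B P.word_dist_mult_le [OF assms(3,4)] by (simp add: PSLZ_class_mult PSLZ_class_in_carrier)
    moreover have "ln (SLZ_norm (A ** B)) \<le> ln (SLZ_norm A * SLZ_norm B)"
      using SLZ_norm_mult_le [of A B] SLZ_norm_ge_1 [of "A ** B"] A B
      by (subst ln_le_cancel_iff) (auto simp: det_mul)
    moreover have "ln (SLZ_norm A * SLZ_norm B) = ln (SLZ_norm A) + ln (SLZ_norm B)"
      using SLZ_norm_ge_1 [OF A] SLZ_norm_ge_1 [OF B] by (simp add: ln_mult)
    ultimately show "real (?W (PSLZ_class (A ** B))) + ln (SLZ_norm (A ** B)) \<le>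
        real (?W (PSLZ_class A)) + ln (SLZ_norm A) + (real (?W (PSLZ_class B)) + ln (SLZ_norm B))"
      by simp
  qed
  obtain K where K: "0 \<le> K" "\<And>A B X. det A = 1 \<Longrightarrow> det B = 1 \<Longrightarrow> B ** A = mat 1 \<Longrightarrow>
      2 \<le> X \<Longrightarrow> SLZ_norm A \<le> X \<Longrightarrow> real (?W (PSLZ_class B)) + ln (SLZ_norm B) \<le> K * ln X"
    using len_inverse_le_ln_norm [OF assms(1)] by blast
  obtain \<delta> where \<delta>: "0 < \<delta>" "\<And>A :: int ^ 'd ^ 'd. 1 < SLZ_norm A \<Longrightarrow> \<delta> \<le> ln (SLZ_norm A)"
    using SLZ_norm_gap by blast
  have W: "real (?W (PSLZ_class A)) \<le> K * ln X" if A: "det A = 1" "2 \<le> X" "SLZ_norm A \<le> X" for A X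
  proof -
    obtain B where B: "det B = 1" "B ** A = mat 1"
      using SLZ_left_inverse A(1) by blast
    then have "PSLZ_class B \<otimes>\<^bsub>PSLZ\<^esub> PSLZ_class A = \<one>\<^bsub>PSLZ\<^esub>"
      using A(1) by (simp add: PSLZ_class_mult [symmetric] PSLZ_class_one)
    then have "PSLZ_class A = inv\<^bsub>PSLZ\<^esub> PSLZ_class B"
      using A(1) B(1) by (metis P.inv_equality P.inv_inv PSLZ_class_in_carrier)
    then have "?W (PSLZ_class A) \<le> ?W (PSLZ_class B)"
      using P.word_dist_inv_le [OF assms(3,4)] B(1) by (simp add: PSLZ_class_in_carrier)
    moreover have "0 \<le> ln (SLZ_norm B)"
      using SLZ_norm_ge_1 [OF B(1)] by simp
    ultimately show ?thesis
      using K(2) [OF A(1) B A(2,3)] by simp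
  qed
  show ?thesis
  proof (intro exI conjI ballI impI)
    \<comment> \<open>\<open>K\<close> serves norms above 2, \<open>K * ln 2 / \<delta>\<close>
      serves norms in (1, 2], where the reduction is applied with \<open>X = 2\<close>, and the 1
      ensures positivity even for \<open>K = 0\<close>.\<close>
    show "0 < K + K * ln 2 / \<delta> + 1"
      using K(1) \<delta>(1) by (simp add: add_nonneg_pos)
    fix \<gamma> :: "(int ^ 'd ^ 'd) set"
    assume \<gamma>: "\<gamma> \<in> carrier PSLZ" "\<gamma> = \<one>\<^bsub>PSLZ\<^esub> \<or> 1 < PSLZ_norm \<gamma>"
    obtain A where A: "det A = 1" "\<gamma> = PSLZ_class A" "PSLZ_norm \<gamma> = SLZ_norm A"
      using PSLZ_class_cases [OF \<gamma>(1)] by blast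
    let ?l = "ln (SLZ_norm A)"
    have l: "0 \<le> ?l"
      using SLZ_norm_ge_1 [OF A(1)] by simp
    have "real (?W \<gamma>) \<le> (K + K * ln 2 / \<delta> + 1) * ?l"
    proof (cases "\<gamma> = \<one>\<^bsub>PSLZ\<^esub>")
      case True
      with l K(1) \<delta>(1) show ?thesis
        by (simp add: P.word_dist_one_one)
    next
      case False
      then have "\<delta> \<le> ?l"
        using \<gamma>(2) A(3) \<delta>(2) by auto
      then have "ln 2 * \<delta> \<le> ln 2 * ?l"
        by (intro mult_left_mono) auto
      then have "ln 2 \<le> ln 2 / \<delta> * ?l"
        using \<delta>(1) by (simp add: field_simps)
      then have "K * ln 2 \<le> K * (ln 2 / \<delta> * ?l)"
        using K(1) by (rule mult_left_mono)
      moreover have "real (?W \<gamma>) \<le> K * ln 2 \<or> real (?W \<gamma>) \<le> K * ?l"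
        using W [OF A(1), of 2] W [OF A(1), of "SLZ_norm A"] A(2) by (cases "SLZ_norm A \<le> 2") auto
      moreover have "0 \<le> K * ?l" "0 \<le> K * (ln 2 / \<delta> * ?l)"
        using K(1) l \<delta>(1) by auto
      moreover have "(K + K * ln 2 / \<delta> + 1) * ?l = K * ?l + K * (ln 2 / \<delta> * ?l) + ?l"
        by (simp add: algebra_simps)
      ultimately show ?thesis
        using l by linarith
    qed
    then show "real (?W \<gamma>) \<le> (K + K * ln 2 / \<delta> + 1) * ln (PSLZ_norm \<gamma>)"
      by (simp add: A(3))
  qed
qed

end
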